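(* Let $\Delta\neq\mathbb{N}$ be a numerical semigroup and let $d\ge2$ be an integer. Let $x\in\Delta$ with $\gcd(x,d)=1$, and set $S=\langle x\rangle+d\Delta$. Then $$\operatorname{F}(S)=d\operatorname{F}(\Delta)+(d-1)x,\qquad \operatorname{g}(S)=d\operatorname{g}(\Delta)+\frac{(d-1)(x-1)}{2}.$$
   Context: $\mathbb{N}=\{0,1,2,\dots\}$. A numerical semigroup is a submonoid of $(\mathbb{N},+)$ with finite complement in $\mathbb{N}$. For a numerical semigroup $S$, $\operatorname{F}(S)=\max(\mathbb{Z}\setminus S)$ is the Frobenius number and $\operatorname{g}(S)=|\mathbb{N}\setminus S|$ the genus. $\langle x\rangle=\{kx:k\in\mathbb{N}\}$, $d\Delta=\{d\delta:\delta\in\Delta\}$, and $A+B=\{a+b:a\in A,b\in B\}$. Under the stated hypotheses $S$ is a numerical semigroup. *)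

theory Defs
  imports Complex_Main "HOL-Library.Set_Algebras"
begin

definition numerical_semigroup :: "nat set \<Rightarrow> bool" where
  "numerical_semigroup S \<longleftrightarrow>
     0 \<in> S \<and> (\<forall>a\<in>S. \<forall>b\<in>S. a + b \<in> S) \<and> finite (- S)"

(* The maximum is taken over the integers outside S, so that the value for the full set of
   naturals is -1. This set is unbounded below, hence Greatest instead of Max, which is
   only meaningful on finite sets. *)
definition frobenius_number :: "nat set \<Rightarrow> int" where
  "frobenius_number S = (GREATEST z::int. z \<notin> int ` S)"

definition genus :: "nat set \<Rightarrow> nat" where
  "genus S = card (- S)"

definition multiples :: "nat \<Rightarrow> nat set" where
  "multiples x = {k * x | k. True}"

definition dilate :: "nat \<Rightarrow> nat set \<Rightarrow> nat set" where
  "dilate d A = {d * a | a. a \<in> A}"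

end

theory Submission
  imports Defs "HOL-Number_Theory.Cong"
begin

text \<open>Since \<open>x\<close> is invertible modulo \<open>d\<close>, every integer is \<open>i x + d w\<close> for exactly one pair
  \<open>(i, w)\<close> with \<open>0 \<le> i < d\<close>, and it lies in \<open>S\<close> iff \<open>w \<in> \<Delta>\<close>: surplus multiples of \<open>d x\<close> are
  absorbed by \<open>\<Delta>\<close> because \<open>x \<in> \<Delta>\<close>. So the largest integer outside \<open>S\<close> has \<open>i = d - 1\<close> and
  \<open>w = F(\<Delta>)\<close>. The gaps of \<open>S\<close> with \<open>w \<ge> 0\<close> number \<open>d g(\<Delta>)\<close>; those with \<open>w < 0\<close> correspond to
  the lattice points strictly below the diagonal of a \<open>d\<close> by \<open>x\<close> rectangle, which are half of
  the \<open>(d - 1)(x - 1)\<close> interior points.\<close>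

lemma numerical_semigroup_mult:
  assumes "numerical_semigroup A" "a \<in> A"
  shows "k * a \<in> A"
  using assms by (induction k) (auto simp: numerical_semigroup_def)

lemma frobenius_number_eqI:
  assumes "z \<notin> int ` A" "\<And>y. y \<notin> int ` A \<Longrightarrow> y \<le> z"
  shows "frobenius_number A = z"
  unfolding frobenius_number_def using assms by (rule Greatest_equality)

text \<open>\<open>GREATEST\<close> says something only once a maximum is known to exist. A proper
  numerical semigroup has a finite nonempty set of natural gaps, and the largest of these also
  dominates every negative integer.\<close>

lemma frobenius_number_greatest_gap:
  assumes "numerical_semigroup A" "A \<noteq> UNIV"
  shows "frobenius_number A \<notin> int ` A"
    and "z \<notin> int ` A \<Longrightarrow> z \<le> frobenius_number A"
proof -
  have fin: "finite (- A)" and ne: "- A \<noteq> {}"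
    using assms by (auto simp: numerical_semigroup_def)
  have notin: "int (Max (- A)) \<notin> int ` A"
    using Max_in[OF fin ne] by auto
  have le: "z \<le> int (Max (- A))" if "z \<notin> int ` A" for z
  proof (cases "z < 0")
    case False
    then have "nat z \<in> - A" using that by (metis ComplI imageI int_nat_eq not_less)
    then show ?thesis using Max_ge[OF fin, of "nat z"] by linarith
  qed auto
  have "frobenius_number A = int (Max (- A))"
    by (rule frobenius_number_eqI[OF notin le])
  then show "frobenius_number A \<notin> int ` A"
    and "z \<notin> int ` A \<Longrightarrow> z \<le> frobenius_number A"
    using notin le by auto
qed

text \<open>Reducing modulo \<open>d\<close> leaves \<open>(a - b) * x\<close>, and \<open>x\<close>
  can be cancelled. This fixes the coefficient of \<open>x\<close> modulo \<open>d\<close>, both for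
  membership in the semigroup and for injectivity.\<close>

lemma dvd_diff_mult_coprime:
  fixes a b :: int
  assumes "a * int x + int d * u = b * int x + int d * v" "coprime x d"
  shows "int d dvd a - b"
proof -
  have "(a - b) * int x = int d * (v - u)"
    using assms(1) by (simp add: algebra_simps)
  then have "int d dvd (a - b) * int x" by simp
  moreover have "coprime (int d) (int x)"
    using assms(2) by (simp add: coprime_commute)
  ultimately show ?thesis by (simp add: coprime_dvd_mult_left_iff)
qed

lemma int_in_multiples_plus_dilate_iff:
  assumes A: "numerical_semigroup A" "x \<in> A" and "coprime x d" and "i < d"
  shows "int i * int x + int d * w \<in> int ` (multiples x + dilate d A) \<longleftrightarrow> w \<in> int ` A"
proof
  assume "w \<in> int ` A"
  then obtain a where a: "w = int a" "a \<in> A" by auto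
  have "i * x + d * a \<in> multiples x + dilate d A"
    using a by (intro set_plus_intro) (auto simp: multiples_def dilate_def)
  moreover have "int i * int x + int d * w = int (i * x + d * a)"
    using a by simp
  ultimately show "int i * int x + int d * w \<in> int ` (multiples x + dilate d A)"
    by (metis imageI)
next
  assume "int i * int x + int d * w \<in> int ` (multiples x + dilate d A)"
  then obtain b c where "b \<in> multiples x" "c \<in> dilate d A"
    and bc: "int i * int x + int d * w = int (b + c)"
    by (auto elim!: set_plus_elim)
  then obtain k a where "b = k * x" "c = d * a" and a: "a \<in> A"
    by (auto simp: multiples_def dilate_def)
  with bc have eq: "int k * int x + int d * int a = int i * int x + int d * w" by simp
  from dvd_diff_mult_coprime[OF eq \<open>coprime x d\<close>]
  obtain q where q: "int k = int i + int d * q" by (auto simp: dvd_def algebra_simps)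
  \<comment> \<open>As \<open>i < d\<close>, a negative \<open>q\<close> would make
    \<open>int k = int i + int d * q\<close> negative.\<close>
  have "q \<ge> 0"
  proof (rule ccontr)
    assume "\<not> q \<ge> 0"
    then have "int d * q \<le> int d * (-1)" by (intro mult_left_mono) auto
    then show False using q \<open>i < d\<close> by simp
  qed
  have "int d * w = int d * (q * int x + int a)"
    using eq unfolding q by (simp add: algebra_simps)
  then have "w = q * int x + int a" using \<open>i < d\<close> by simp
  then have "w = int (nat q * x + a)" using \<open>q \<ge> 0\<close> by simp
  moreover have "nat q * x + a \<in> A"
    using A a numerical_semigroup_mult[OF A] by (auto simp: numerical_semigroup_def)
  ultimately show "w \<in> int ` A" by blast
qed

lemma int_residue_representation:
  assumes "coprime x d" "d > 0"
  obtains i w where "i < d" "z = int i * int x + int d * w"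
proof -
  obtain y where y: "[int x * y = 1] (mod int d)"
    using cong_solve_coprime_int[of "int x" "int d"] assms by auto
  \<comment> \<open>With \<open>y\<close> inverse to \<open>x\<close> modulo \<open>d\<close>, the
    condition \<open>i * x = z\<close> modulo \<open>d\<close> is solved by the residue of
    \<open>y * z\<close>.\<close>
  define i where "i = nat ((y * z) mod int d)"
  have i: "int i = (y * z) mod int d" "i < d"
    using assms by (simp_all add: i_def nat_less_iff)
  have "[int i * int x = (y * z) * int x] (mod int d)"
    unfolding i by (simp add: cong_def mod_mult_left_eq)
  also have "(y * z) * int x = (int x * y) * z" by (simp add: algebra_simps)
  also have "[(int x * y) * z = 1 * z] (mod int d)"
    using y by (rule cong_scalar_right)
  finally have "int d dvd z - int i * int x"
    by (simp add: cong_iff_dvd_diff dvd_diff_commute)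
  then obtain w where "z = int i * int x + int d * w" by (auto simp: dvd_def algebra_simps)
  with i that show thesis by blast
qed

lemma inj_on_residue_representation:
  assumes "coprime x d"
  shows "inj_on (\<lambda>(i, w). int i * int x + int d * w) ({..<d} \<times> UNIV)"
proof (rule inj_onI, clarify)
  fix i j u v
  assume ij: "i < d" "j < d" and eq: "int i * int x + int d * u = int j * int x + int d * v"
  have "int d dvd int i - int j"
    by (rule dvd_diff_mult_coprime[OF eq assms])
  \<comment> \<open>Distinct indices below \<open>d\<close> differ by less than \<open>d\<close>;
    the divisibility bound needs a positive difference, hence both orders.\<close>
  then have "i = j"
    using ij zdvd_imp_le[of "int d" "int i - int j"] zdvd_imp_le[of "int d" "int j - int i"]
    by (cases i j rule: linorder_cases) (auto simp: dvd_diff_commute)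
  with eq ij show "i = j \<and> u = v" by simp
qed

lemma coprime_mult_neq_mult:
  fixes d x :: nat
  assumes "coprime x d" "0 < i" "i < d"
  shows "d * j \<noteq> i * x"
proof
  assume "d * j = i * x"
  then have "d dvd i * x" by (metis dvd_triv_left)
  then have "d dvd i" using assms by (simp add: coprime_commute coprime_dvd_mult_left_iff)
  then show False using assms by (auto dest: dvd_imp_le)
qed

text \<open>The point reflection \<open>(i, j)\<close> to \<open>(d - i, x - j)\<close> swaps the
  two sides of the diagonal, and coprimality keeps interior lattice points off the diagonal
  itself.\<close>

lemma card_lattice_points_below_diagonal:
  fixes d x :: nat
  assumes "coprime x d"
  shows "2 * card {(i, j). i \<in> {1..<d} \<and> j \<in> {1..<x} \<and> d * j < i * x} = (d - 1) * (x - 1)"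
proof -
  let ?R = "{1..<d} \<times> {1..<x}"
  let ?T = "{(i, j). i \<in> {1..<d} \<and> j \<in> {1..<x} \<and> d * j < i * x}"
  let ?U = "{(i, j). i \<in> {1..<d} \<and> j \<in> {1..<x} \<and> d * j > i * x}"
  have fin: "finite ?T" "finite ?U"
    by (rule finite_subset[of _ ?R]; auto)+
  have R: "?R = ?T \<union> ?U"
  proof (intro equalityI subsetI)
    fix p assume "p \<in> ?R"
    then obtain i j where p: "p = (i, j)" "i \<in> {1..<d}" "j \<in> {1..<x}" by blast
    then have "d * j < i * x \<or> d * j > i * x"
      using coprime_mult_neq_mult[OF assms, of i j] by (simp add: neq_iff)
    then show "p \<in> ?T \<union> ?U" using p by blast
  qed auto
  have "card ?R = card (?T \<union> ?U)" by (rule arg_cong[OF R])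
  also have "\<dots> = card ?T + card ?U" by (rule card_Un_disjoint[OF fin]) auto
  finally have "card ?R = card ?T + card ?U" .
  moreover have "bij_betw (\<lambda>(i, j). (d - i, x - j)) ?T ?U"
  proof (rule bij_betw_byWitness[where f' = "\<lambda>(i, j). (d - i, x - j)"])
    have reflect: "d * (x - j) < (d - i) * x \<longleftrightarrow> i * x < d * j"
      "(d - i) * x < d * (x - j) \<longleftrightarrow> d * j < i * x"
      if "i < d" "j < x" for i j
    proof -
      \<comment> \<open>These bounds ensure that the natural subtractions are not truncated.\<close>
      have "i * x \<le> d * x" "d * j \<le> d * x" using that by auto
      then show "d * (x - j) < (d - i) * x \<longleftrightarrow> i * x < d * j"
        "(d - i) * x < d * (x - j) \<longleftrightarrow> d * j < i * x"
        unfolding diff_mult_distrib diff_mult_distrib2 by linarith+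
    qed
    show "(\<lambda>(i, j). (d - i, x - j)) ` ?T \<subseteq> ?U" "(\<lambda>(i, j). (d - i, x - j)) ` ?U \<subseteq> ?T"
      by (auto simp: reflect)
  qed auto
  then have "card ?T = card ?U" by (rule bij_betw_same_card)
  ultimately show ?thesis by simp
qed

lemma frobenius_number_multiples_plus_dilate:
  assumes A: "numerical_semigroup A" "x \<in> A" and "A \<noteq> UNIV" and cop: "coprime x d" and "d > 0"
  shows "frobenius_number (multiples x + dilate d A)
    = int d * frobenius_number A + (int d - 1) * int x"
proof -
  let ?S = "multiples x + dilate d A"
  let ?m = "frobenius_number A"
  note gap = frobenius_number_greatest_gap[OF A(1) \<open>A \<noteq> UNIV\<close>]
  show ?thesis
  proof (rule frobenius_number_eqI)
    have "int (d - 1) * int x + int d * ?m \<notin> int ` ?S"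
      using gap(1) \<open>d > 0\<close> by (subst int_in_multiples_plus_dilate_iff[OF A cop]) auto
    then show "int d * ?m + (int d - 1) * int x \<notin> int ` ?S"
      using \<open>d > 0\<close> by (simp add: of_nat_diff add.commute)
    fix z assume z: "z \<notin> int ` ?S"
    obtain i w where iw: "i < d" "z = int i * int x + int d * w"
      using int_residue_representation[OF cop \<open>d > 0\<close>] .
    then have "w \<le> ?m"
      using z int_in_multiples_plus_dilate_iff[OF A cop] gap(2) by metis
    \<comment> \<open>The two coefficients are bounded independently, and both bounds are attained
      at once by the gap found above.\<close>
    moreover have "int i \<le> int d - 1" using iw by simp
    ultimately show "z \<le> int d * ?m + (int d - 1) * int x"
      unfolding iw(2) by (subst (2) add.commute) (intro add_mono mult_left_mono mult_right_mono; simp)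
  qed
qed

text \<open>Doubling keeps the count in the naturals. \<open>?P\<close> collects the pairs whose
  \<open>w\<close> is a natural gap of \<open>A\<close>, \<open>?Q\<close> those with
  \<open>w < 0\<close> but a nonnegative value.\<close>

lemma genus_multiples_plus_dilate:
  assumes A: "numerical_semigroup A" "x \<in> A" and cop: "coprime x d" and "d > 0"
  shows "2 * genus (multiples x + dilate d A) = 2 * d * genus A + (d - 1) * (x - 1)"
proof -
  let ?S = "multiples x + dilate d A"
  let ?f = "\<lambda>(i, w). int i * int x + int d * w"
  let ?T = "{(i, j). i \<in> {1..<d} \<and> j \<in> {1..<x} \<and> d * j < i * x}"
  let ?P = "{..<d} \<times> int ` (- A)"
  let ?Q = "(\<lambda>(i, j). (i, - int j)) ` ?T"
  have finA: "finite (- A)" using A by (simp add: numerical_semigroup_def)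
  have finT: "finite ?T" by (rule finite_subset[of _ "{1..<d} \<times> {1..<x}"]) auto
  have Q: "(i, w) \<in> ?Q" if "i < d" "w < 0" "?f (i, w) \<ge> 0" for i w
  proof -
    define j where "j = nat (- w)"
    have w: "w = - int j" and "j \<ge> 1" using that by (auto simp: j_def)
    have "int (d * j) \<le> int (i * x)" using that w by simp
    then have le: "d * j \<le> i * x" by linarith
    have "i > 0" using le \<open>j \<ge> 1\<close> \<open>d > 0\<close> by (cases i) auto
    \<comment> \<open>Equality is excluded by coprimality; strictness is what then gives
      \<open>j < x\<close>.\<close>
    have lt: "d * j < i * x"
      using le coprime_mult_neq_mult[OF cop \<open>i > 0\<close> \<open>i < d\<close>, of j] by linarith
    also have "\<dots> \<le> d * x" using \<open>i < d\<close> by simp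
    finally have "j < x" by simp
    then show ?thesis using w lt \<open>j \<ge> 1\<close> \<open>i > 0\<close> \<open>i < d\<close> by (auto intro!: image_eqI[of _ _ "(i, j)"])
  qed
  have "int ` (- ?S) = ?f ` (?P \<union> ?Q)"
  proof (intro equalityI subsetI)
    fix z assume "z \<in> int ` (- ?S)"
    then have z: "z \<ge> 0" "z \<notin> int ` ?S" by auto
    obtain i w where iw: "i < d" "z = int i * int x + int d * w"
      using int_residue_representation[OF cop \<open>d > 0\<close>] .
    then have w: "w \<notin> int ` A" using z int_in_multiples_plus_dilate_iff[OF A cop] by metis
    have "(i, w) \<in> ?P \<union> ?Q"
    proof (cases "w < 0")
      case True
      then show ?thesis using Q[of i w] iw z by simp
    next
      case False
      then have "w = int (nat w)" "nat w \<notin> A" using w by (auto simp: image_iff)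
      then show ?thesis using iw by blast
    qed
    then show "z \<in> ?f ` (?P \<union> ?Q)" using iw by (auto intro: rev_image_eqI)
  next
    fix z assume "z \<in> ?f ` (?P \<union> ?Q)"
    then obtain i w where iw: "(i, w) \<in> ?P \<union> ?Q" "z = int i * int x + int d * w"
      by (elim imageE) (metis (mono_tags, lifting) case_prod_conv surj_pair)
    have "z \<ge> 0"
    proof (cases "(i, w) \<in> ?P")
      case False
      then obtain j where "w = - int j" "d * j < i * x" using iw by auto
      then have "int (d * j) < int (i * x)" by linarith
      then show ?thesis using iw \<open>w = - int j\<close> by simp
    qed (auto simp: iw)
    moreover have "i < d" "w \<notin> int ` A" using iw(1) by auto
    then have "z \<notin> int ` ?S"
      using int_in_multiples_plus_dilate_iff[OF A cop] iw by metis
    ultimately show "z \<in> int ` (- ?S)" by (metis ComplI imageI int_nat_eq)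
  qed
  then have "genus ?S = card (?f ` (?P \<union> ?Q))"
    by (metis genus_def card_image inj_on_of_nat)
  also have "\<dots> = card (?P \<union> ?Q)"
    by (rule card_image, rule inj_on_subset[OF inj_on_residue_representation[OF cop]]) auto
  \<comment> \<open>The sign of the second component separates \<open>?P\<close> from
    \<open>?Q\<close>.\<close>
  also have "\<dots> = card ?P + card ?Q"
    using finA finT by (intro card_Un_disjoint) auto
  also have "card ?P = d * genus A"
    by (simp add: genus_def card_cartesian_product card_image)
  also have "card ?Q = card ?T"
    by (rule card_image) (auto simp: inj_on_def)
  finally show ?thesis
    using card_lattice_points_below_diagonal[OF cop] by simp
qed

theorem theorem4p14:
  fixes \<Delta> S :: "nat set" and d x :: nat
  assumes "numerical_semigroup \<Delta>"
    and "\<Delta> \<noteq> UNIV"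
    and "d \<ge> 2"
    and "x \<in> \<Delta>"
    and "gcd x d = 1"
    and "S = multiples x + dilate d \<Delta>"
  shows "frobenius_number S = int d * frobenius_number \<Delta> + (int d - 1) * int x
       \<and> real (genus S) = real d * real (genus \<Delta>) + (real d - 1) * (real x - 1) / 2"
proof -
  have cop: "coprime x d" using assms(5) by (simp add: coprime_iff_gcd_eq_1)
  \<comment> \<open>For \<open>x = 0\<close> the gcd would be \<open>d \<ge> 2\<close>. Positivity
    lets the truncated \<open>x - 1\<close> agree with the real one.\<close>
  have "x > 0" using assms(3,5) by (cases x) auto
  have "2 * real (genus S) = real (2 * d * genus \<Delta> + (d - 1) * (x - 1))"
    using genus_multiples_plus_dilate[OF assms(1,4) cop] assms(3,6) by (simp flip: of_nat_mult)
  then have "real (genus S) = real d * real (genus \<Delta>) + (real d - 1) * (real x - 1) / 2"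
    using \<open>x > 0\<close> assms(3) by (simp add: of_nat_diff)
  then show ?thesis
    using frobenius_number_multiples_plus_dilate[OF assms(1,4,2) cop] assms(3,6) by simp
qed

end
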